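(* For all LTL formulae $\varphi$: (1) $\mathrm{Pr}([\![\varphi]\!]_3(\mathrm{T})) = [\![\varphi]\!](\mathrm{T})$; (2) $\mathrm{Pr}([\![\varphi]\!]_3(\mathrm{F})) = [\![\varphi]\!](\mathrm{F})$.
   Context: Traces. Fix a set $A$ of atomic propositions and let $\Sigma = \mathcal{P}(A)$ be the set of states. $\Sigma^*$ is the set of finite traces (including the empty trace $\varepsilon$), $\Sigma^\omega$ the set of infinite traces, $\Sigma^\infty = \Sigma^* \cup \Sigma^\omega$. Concatenation is written $tu$, with $tu = t$ if $t$ is infinite. $t_0$ is the first state of a nonempty trace $t$; $t|_n$ is $t$ without its first $n$ states ($\varepsilon$ if $n$ exceeds the length of $t$). Definitive sets. For $X \subseteq \Sigma^\infty$, $\downarrow X = \{u \mid \exists t \in X.\ \exists v \in \Sigma^\infty.\ t = uv\}$; $\uparrow t = \{tu \mid u \in \Sigma^\infty\}$; $\mathrm{dp}(X) = \{t \in \Sigma^\infty\mid \uparrow t \subseteq \downarrow X\}$. $X$ is definitive iff $X = \mathrm{dp}(X)$. Definitive union: $X \sqcup Y = \mathrm{dp}(X \cup Y)$ and $\bigsqcup S = \mathrm{dp}(\bigcup S)$. Prepend: $\triangleright X = \{t \in \Sigma^\infty \mid t|_1 \in X\}$. For a definitive set $X$, $\mathrm{Pr}(X) = X \cap \Sigma^\omega$. LTL formulae: $\varphi,\psi ::= \top \mid a \mid \neg\varphi \mid \varphi\wedge\psi \mid \bigcirc\varphi \mid \varphi\,\mathcal{U}\,\psi$ with $a \in A$;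 $\varphi\vee\psi$ abbreviates $\neg(\neg\varphi\wedge\neg\psi)$. Conventional LTL semantics $[\![\varphi]\!] : \{\mathrm{T},\mathrm{F}\} \to \mathcal{P}(\Sigma^\omega)$, by recursion: $[\![\top]\!](\mathrm{T}) = \Sigma^\omega$, $[\![\top]\!](\mathrm{F}) = \emptyset$; $[\![a]\!](\mathrm{T}) = \{t\in\Sigma^\omega \mid a \in t_0\}$, $[\![a]\!](\mathrm{F}) = \{t\in\Sigma^\omega \mid a \notin t_0\}$; $[\![\neg\varphi]\!](\mathrm{T}) = [\![\varphi]\!](\mathrm{F})$, $[\![\neg\varphi]\!](\mathrm{F}) = [\![\varphi]\!](\mathrm{T})$; $[\![\varphi\wedge\psi]\!](\mathrm{T}) = [\![\varphi]\!](\mathrm{T})\cap[\![\psi]\!](\mathrm{T})$, $[\![\varphi\wedge\psi]\!](\mathrm{F}) = [\![\varphi]\!](\mathrm{F})\cup[\![\psi]\!](\mathrm{F})$; $[\![\bigcirc\varphi]\!](b) = \{t \mid t|_1 \in [\![\varphi]\!](b)\}$ for $b\in\{\mathrm{T},\mathrm{F}\}$; $[\![\varphi\,\mathcal{U}\,\psi]\!](\mathrm{T}) = \{t \mid \exists k.\ (\forall i<k.\ t|_i \in [\![\varphi]\!](\mathrm{T})) \wedge t|_k \in [\![\psi]\!](\mathrm{T})\}$, $[\![\varphi\,\mathcal{U}\,\psi]\!](\mathrm{F}) = \{t \mid \forall k.\ (\exists i<k.\ t|_i \in [\![\varphi]\!](\mathrm{F})) \vee t|_k \in [\![\psi]\!](\mathrm{F})\}$.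 LTL$_3$ semantics $[\![\varphi]\!]_3$ assigns to each answer in $\{\mathrm{T},\mathrm{F}\}$ a definitive set, by recursion: $[\![\top]\!]_3(\mathrm{T}) = \Sigma^\infty$, $[\![\top]\!]_3(\mathrm{F}) = \emptyset$; $[\![a]\!]_3(\mathrm{T}) = \mathrm{dp}\{t\in\Sigma^\infty \mid t\ne\varepsilon \wedge a \in t_0\}$, $[\![a]\!]_3(\mathrm{F}) = \mathrm{dp}\{t\in\Sigma^\infty \mid t\neq\varepsilon \wedge a \notin t_0\}$; $[\![\neg\varphi]\!]_3(\mathrm{T}) = [\![\varphi]\!]_3(\mathrm{F})$, $[\![\neg\varphi]\!]_3(\mathrm{F}) = [\![\varphi]\!]_3(\mathrm{T})$; $[\![\varphi\wedge\psi]\!]_3(\mathrm{T}) = [\![\varphi]\!]_3(\mathrm{T})\cap[\![\psi]\!]_3(\mathrm{T})$, $[\![\varphi\wedge\psi]\!]_3(\mathrm{F}) = [\![\varphi]\!]_3(\mathrm{F})\sqcup[\![\psi]\!]_3(\mathrm{F})$; $[\![\bigcirc\varphi]\!]_3(b) = \triangleright([\![\varphi]\!]_3(b))$ for $b\in\{\mathrm{T},\mathrm{F}\}$; $[\![\varphi\,\mathcal{U}\,\psi]\!]_3(\mathrm{T}) = \bigsqcup_{k\in\mathbb{N}} f^k([\![\psi]\!]_3(\mathrm{T}))$ where $f(X) = \triangleright X \cap [\![\varphi]\!]_3(\mathrm{T})$; $[\![\varphi\,\mathcal{U}\,\psi]\!]_3(\mathrm{F}) = \bigcap_{k\in\mathbb{N}}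 g^k([\![\psi]\!]_3(\mathrm{F}))$ where $g(X) = \triangleright X \sqcup [\![\varphi]\!]_3(\mathrm{F})$. Here $f^k$ is the $k$-fold self-composition of $f$ ($f^0$ the identity). *)

theory Defs
  imports "HOL-Library.Stream"
begin

section \<open>Traces\<close>

datatype 's trace = Fin "'s list" | Inf "'s stream"

abbreviation empty_trace :: "'s trace" ("\<epsilon>") where
  "\<epsilon> \<equiv> Fin []"

fun tconc :: "'s trace \<Rightarrow> 's trace \<Rightarrow> 's trace" (infixr "\<frown>" 65) where
  "Fin xs \<frown> Fin ys = Fin (xs @ ys)"
| "Fin xs \<frown> Inf s = Inf (xs @- s)"
| "Inf s \<frown> u = Inf s"

text \<open>The first state is only meaningful for nonempty traces.\<close>

fun thd :: "'s trace \<Rightarrow> 's" where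
  "thd (Fin xs) = hd xs"
| "thd (Inf s) = shd s"

fun tdrop :: "nat \<Rightarrow> 's trace \<Rightarrow> 's trace" where
  "tdrop n (Fin xs) = Fin (drop n xs)"
| "tdrop n (Inf s) = Inf (sdrop n s)"

text \<open>The set \<open>A\<close> of atomic propositions is a parameter (and not a type), so
  that it may also be empty. States are the subsets of \<open>A\<close>.\<close>

definition fin_traces :: "'a set \<Rightarrow> 'a set trace set" where
  "fin_traces A = Fin ` lists (Pow A)"

definition inf_traces :: "'a set \<Rightarrow> 'a set trace set" where
  "inf_traces A = Inf ` streams (Pow A)"

definition traces :: "'a set \<Rightarrow> 'a set trace set" where
  "traces A = fin_traces A \<union> inf_traces A"


section \<open>Definitive sets\<close>

definition prefixes :: "'a set \<Rightarrow> 'a set trace set \<Rightarrow> 'a set trace set" where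
  "prefixes A X = {u \<in> traces A. \<exists>t\<in>X. \<exists>v\<in>traces A. t = u \<frown> v}"

definition extensions :: "'a set \<Rightarrow> 'a set trace \<Rightarrow> 'a set trace set" where
  "extensions A t = {t \<frown> u | u. u \<in> traces A}"

definition dp :: "'a set \<Rightarrow> 'a set trace set \<Rightarrow> 'a set trace set" where
  "dp A X = {t \<in> traces A. extensions A t \<subseteq> prefixes A X}"

definition definitive :: "'a set \<Rightarrow> 'a set trace set \<Rightarrow> bool" where
  "definitive A X \<longleftrightarrow> X = dp A X"

definition dunion :: "'a set \<Rightarrow> 'a set trace set \<Rightarrow> 'a set trace set \<Rightarrow> 'a set trace set" where
  "dunion A X Y = dp A (X \<union> Y)"

definition dUnion :: "'a set \<Rightarrow> 'a set trace set set \<Rightarrow> 'a set trace set" where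
  "dUnion A S = dp A (\<Union>S)"

definition prepend :: "'a set \<Rightarrow> 'a set trace set \<Rightarrow> 'a set trace set" where
  "prepend A X = {t \<in> traces A. tdrop 1 t \<in> X}"

text \<open>\<open>Pr\<close> is only meant for definitive sets; since it is an intersection, it is
  defined on all sets here.\<close>

definition Pr :: "'a set \<Rightarrow> 'a set trace set \<Rightarrow> 'a set trace set" where
  "Pr A X = X \<inter> inf_traces A"


section \<open>Linear temporal logic\<close>

datatype (atoms: 'a) ltl =
    Top
  | Atom 'a
  | Neg "'a ltl"
  | Conj "'a ltl" "'a ltl"
  | Next "'a ltl"
  | Until "'a ltl" "'a ltl"

datatype answer = T | F

fun ltl_sem :: "'a set \<Rightarrow> 'a ltl \<Rightarrow> answer \<Rightarrow> 'a set trace set" where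
  "ltl_sem A Top T = inf_traces A"
| "ltl_sem A Top F = {}"
| "ltl_sem A (Atom a) T = {t \<in> inf_traces A. a \<in> thd t}"
| "ltl_sem A (Atom a) F = {t \<in> inf_traces A. a \<notin> thd t}"
| "ltl_sem A (Neg \<phi>) T = ltl_sem A \<phi> F"
| "ltl_sem A (Neg \<phi>) F = ltl_sem A \<phi> T"
| "ltl_sem A (Conj \<phi> \<psi>) T = ltl_sem A \<phi> T \<inter> ltl_sem A \<psi> T"
| "ltl_sem A (Conj \<phi> \<psi>) F = ltl_sem A \<phi> F \<union> ltl_sem A \<psi> F"
| "ltl_sem A (Next \<phi>) b = {t \<in> inf_traces A. tdrop 1 t \<in> ltl_sem A \<phi> b}"
| "ltl_sem A (Until \<phi> \<psi>) T =
    {t \<in> inf_traces A. \<exists>k. (\<forall>i<k. tdrop i t \<in> ltl_sem A \<phi> T) \<and> tdrop k t \<in> ltl_sem A \<psi> T}"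
| "ltl_sem A (Until \<phi> \<psi>) F =
    {t \<in> inf_traces A. \<forall>k. (\<exists>i<k. tdrop i t \<in> ltl_sem A \<phi> F) \<or> tdrop k t \<in> ltl_sem A \<psi> F}"

fun ltl3_sem :: "'a set \<Rightarrow> 'a ltl \<Rightarrow> answer \<Rightarrow> 'a set trace set" where
  "ltl3_sem A Top T = traces A"
| "ltl3_sem A Top F = {}"
| "ltl3_sem A (Atom a) T = dp A {t \<in> traces A. t \<noteq> \<epsilon> \<and> a \<in> thd t}"
| "ltl3_sem A (Atom a) F = dp A {t \<in> traces A. t \<noteq> \<epsilon> \<and> a \<notin> thd t}"
| "ltl3_sem A (Neg \<phi>) T = ltl3_sem A \<phi> F"
| "ltl3_sem A (Neg \<phi>) F = ltl3_sem A \<phi> T"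
| "ltl3_sem A (Conj \<phi> \<psi>) T = ltl3_sem A \<phi> T \<inter> ltl3_sem A \<psi> T"
| "ltl3_sem A (Conj \<phi> \<psi>) F = dunion A (ltl3_sem A \<phi> F) (ltl3_sem A \<psi> F)"
| "ltl3_sem A (Next \<phi>) b = prepend A (ltl3_sem A \<phi> b)"
| "ltl3_sem A (Until \<phi> \<psi>) T =
    dUnion A (range (\<lambda>k. ((\<lambda>X. prepend A X \<inter> ltl3_sem A \<phi> T) ^^ k) (ltl3_sem A \<psi> T)))"
| "ltl3_sem A (Until \<phi> \<psi>) F =
    (\<Inter>k. ((\<lambda>X. dunion A (prepend A X) (ltl3_sem A \<phi> F)) ^^ k) (ltl3_sem A \<psi> F))"

end

(* An infinite trace is its own only extension and its own only infinite prefix, so dp neither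
   adds nor removes infinite traces. On infinite traces the definitive operations are therefore
   the plain set operations, and the two semantics agree clause by clause. *)
theory Submission
  imports Defs
begin

lemma Inf_in_traces_iff [simp]: "Inf s \<in> traces A \<longleftrightarrow> s \<in> streams (Pow A)"
  by (auto simp: traces_def fin_traces_def inf_traces_def)

lemma Inf_in_inf_traces_iff [simp]: "Inf s \<in> inf_traces A \<longleftrightarrow> s \<in> streams (Pow A)"
  by (auto simp: inf_traces_def)

lemma empty_in_traces [simp]: "\<epsilon> \<in> traces A"
  by (simp add: traces_def fin_traces_def)

lemma Inf_in_dp_iff [simp]: "Inf s \<in> dp A X \<longleftrightarrow> s \<in> streams (Pow A) \<and> Inf s \<in> X"
proof -
  have "extensions A (Inf s) = {Inf s}"
    \<comment> \<open>Concatenation to an infinite trace discards its second argument, so any trace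
      can serve as the witness; \<open>\<epsilon>\<close> is one for every \<open>A\<close>.\<close>
    unfolding extensions_def by (auto intro: exI[of _ \<epsilon>])
  moreover have "Inf s \<in> prefixes A X \<longleftrightarrow> s \<in> streams (Pow A) \<and> Inf s \<in> X"
    unfolding prefixes_def by (auto intro: exI[of _ \<epsilon>] simp: Bex_def)
  ultimately show ?thesis
    by (auto simp: dp_def)
qed

lemma Inf_in_prepend_iff [simp]:
  "Inf s \<in> prepend A X \<longleftrightarrow> s \<in> streams (Pow A) \<and> Inf (stl s) \<in> X"
  by (simp add: prepend_def)

text \<open>The outermost application tests \<open>Y\<close> at position 0 and hands the tail to the
  remaining \<open>k\<close> applications. Hence \<open>s\<close> is generalized in the induction,
  and \<open>All_less_Suc2\<close> splits off index 0 rather than the last one.\<close>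

lemma Inf_in_until_iterate_iff:
  assumes "s \<in> streams (Pow A)"
  shows "Inf s \<in> ((\<lambda>X. prepend A X \<inter> Y) ^^ k) Z \<longleftrightarrow>
    (\<forall>i<k. Inf (sdrop i s) \<in> Y) \<and> Inf (sdrop k s) \<in> Z"
  using assms
proof (induction k arbitrary: s)
  case (Suc k)
  then show ?case
    by (auto simp: All_less_Suc2 streams_stl)
qed simp

text \<open>Dual unrolling: at an infinite trace \<open>dunion\<close> is plain disjunction, so each
  layer offers \<open>Y\<close> now or defers to the tail.\<close>

lemma Inf_in_release_iterate_iff:
  assumes "s \<in> streams (Pow A)"
  shows "Inf s \<in> ((\<lambda>X. dunion A (prepend A X) Y) ^^ k) Z \<longleftrightarrow>
    (\<exists>i<k. Inf (sdrop i s) \<in> Y) \<or> Inf (sdrop k s) \<in> Z"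
  using assms
proof (induction k arbitrary: s)
  case (Suc k)
  then show ?case
    by (auto simp: Ex_less_Suc2 streams_stl dunion_def)
qed simp

text \<open>The induction generalizes \<open>b\<close> because negation swaps the answers, and
  \<open>s\<close> because the temporal operators move to suffixes.\<close>

lemma Inf_in_ltl3_sem_iff:
  assumes "s \<in> streams (Pow A)"
  shows "Inf s \<in> ltl3_sem A \<phi> b \<longleftrightarrow> Inf s \<in> ltl_sem A \<phi> b"
  using assms
proof (induction \<phi> arbitrary: s b)
  case (Until \<phi> \<psi>)
  \<comment> \<open>The induction hypotheses are applied at the suffixes of \<open>s\<close>, which
    must again be streams over \<open>Pow A\<close>.\<close>
  have "sdrop i s \<in> streams (Pow A)" for i
    using Until.prems by (induction i arbitrary: s) (simp_all add: streams_stl)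
  with Until show ?case
    by (cases b) (simp_all add: dUnion_def Inf_in_until_iterate_iff Inf_in_release_iterate_iff)
next
  case (Conj \<phi> \<psi>)
  then show ?case
    by (cases b) (simp_all add: dunion_def)
next
  case (Next \<phi>)
  then show ?case
    by (simp add: streams_stl)
next
  case Top
  then show ?case
    by (cases b) simp_all
next
  case (Atom a)
  then show ?case
    by (cases b) simp_all
next
  case (Neg \<phi>)
  then show ?case
    by (cases b) simp_all
qed

text \<open>Excludes finite traces from \<open>ltl_sem\<close>, where the pointwise equivalence says
  nothing.\<close>

lemma ltl_sem_subset_inf_traces: "ltl_sem A \<phi> b \<subseteq> inf_traces A"
proof (induction \<phi> arbitrary: b)
  case (Conj \<phi> \<psi>)
  then show ?case
    by (cases b) (simp_all add: le_infI1)
qed (case_tac b; auto)+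

lemma Pr_ltl3_sem: "Pr A (ltl3_sem A \<phi> b) = ltl_sem A \<phi> b"
  using ltl_sem_subset_inf_traces[of A \<phi> b]
  by (auto simp: Pr_def inf_traces_def Inf_in_ltl3_sem_iff)

theorem theorem7:
  fixes A :: "'a set" and \<phi> :: "'a ltl"
  assumes "atoms \<phi> \<subseteq> A"
  shows "Pr A (ltl3_sem A \<phi> T) = ltl_sem A \<phi> T \<and> Pr A (ltl3_sem A \<phi> F) = ltl_sem A \<phi> F"
  by (simp add: Pr_ltl3_sem)

end
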